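(* Let $A$ be an $\ell\times n$ weight matrix, i.e. $A\in\mathbb{Z}^{\ell\times n}$, with $\ell\le n$, and let $r\le\ell$ denote the rank of $A$. Let $\mathcal{P}_A$, $I_A$, $A'$ and $V_{I_A}$ be as defined in the context. The following are equivalent. 1. The polytope $\mathcal{P}_A$ is combinatorially equivalent to a simplex. 2. By permuting the indices in $I_A$ and performing elementary row operations with integer scalar multiples, the matrix $A'$ can be expressed in the form $$\left[\begin{array}{c|cc} D & C & 0\\ 0 & 0 & 0\end{array}\right],$$ where $D$ is an $r\times r$ diagonal matrix with strictly negative entries on the diagonal and $C$ is an $r\times q$ matrix such that each entry is nonnegative and $q\le |I_A|-r$. 3. There are vectors $\mu_1,\dots,\mu_r\in V_{I_A}$ and indices $j_1,\dots,j_r\in I_A$ such that $\ker(A')=V_{I_A}\cap\left(\bigcap_{i=1}^r\mu_i^\perp\right)$, where $\mu_i^\perp$ denotes the orthogonal complement in $\mathbb{R}^n$, and for each $i=1,\dots,r$, $\langle e_{j_i},\mu_i\rangle<0$, $\langle e_{j_k},\mu_i\rangle=0$ for $k\ne i$, and $\langle e_j,\mu_i\rangle\ge 0$ for $j\in I_A$, $j\ne j_i$. These conditions are trivially satisfied if $n\le r+2$.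
   Context: $e_1,\dots,e_n$ denotes the standard basis of $\mathbb{R}^n$, $\langle\cdot,\cdot\rangle$ the standard inner product on $\mathbb{R}^n$, and $\Delta^{n-1}$ the standard simplex in $\mathbb{R}^n$, i.e. the closed convex hull of $e_1,\dots,e_n$. Set $\mathcal{P}_A=\ker(A)\cap\Delta^{n-1}\subset\mathbb{R}^n$, where $\ker(A)$ is the kernel of $A$ in $\mathbb{R}^n$; if nonempty, $\mathcal{P}_A$ is a polytope. $I_A=\{j\in\{1,\dots,n\} : \exists\,(x_1,\dots,x_n)\in\mathcal{P}_A \text{ with } x_j\ne 0\}$ is the set of indices of coordinates that are not identically $0$ on $\mathcal{P}_A$. $A'$ is the $\ell\times|I_A|$ submatrix of $A$ given by the columns corresponding to elements of $I_A$. $V_{I_A}=\{(x_1,\dots,x_n)\in\mathbb{R}^n : x_j=0\ \forall\, j\notin I_A\}$ is the coordinate subspace associated to $I_A$; it is identified with $\mathbb{R}^{|I_A|}$, so that $\ker(A')$ is regarded as a subspace of $V_{I_A}$. Permuting the indices in $I_A$ means permuting the columns of $A'$.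
   Formalization: In conditions 2 and 3, r is replaced by the rank of A' (the English fails when rank A' < rank A, e.g. A with rows (-1,1,0), (0,0,1)); the last sentence keeps r = rank A in n ≤ r+2; an empty P_A counts as the (-1)-dimensional simplex. *)

theory Defs
  imports "Jordan_Normal_Form.Gauss_Jordan_Elimination" "HOL-Analysis.Analysis"
begin

no_notation Matrix.vec_index (infixl \<open>$\<close> 100)

text \<open>
  An \<open>\<ell> \<times> n\<close> integer matrix is a term of type \<open>int^'n^'l\<close>, where \<open>\<ell> = CARD('l)\<close> and
  \<open>n = CARD('n)\<close>. The type-free matrices of \<open>Jordan_Normal_Form\<close> are used only for the submatrix
  \<open>A'\<close>, whose number of columns depends on \<open>A\<close>.
\<close>

definition std_simplex :: "(real^'n) set" where
  "std_simplex = convex hull (range (\<lambda>j. axis j 1))"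

definition polytope_of :: "int^'n^'l \<Rightarrow> (real^'n) set" where
  "polytope_of A = {x. map_matrix real_of_int A *v x = 0} \<inter> std_simplex"

definition supp_index :: "int^'n^'l \<Rightarrow> 'n set" where
  "supp_index A = {j. \<exists>x \<in> polytope_of A. x $ j \<noteq> 0}"

definition coord_subspace :: "'n set \<Rightarrow> (real^'n) set" where
  "coord_subspace I = {x. \<forall>j. j \<notin> I \<longrightarrow> x $ j = 0}"

definition comb_equiv ::
    "'a::euclidean_space set \<Rightarrow> 'b::euclidean_space set \<Rightarrow> bool" where
  "comb_equiv P Q \<longleftrightarrow>
     (\<exists>f. bij_betw f {F. F face_of P} {G. G face_of Q} \<and>
          (\<forall>F F'. F face_of P \<longrightarrow> F' face_of P \<longrightarrow> (F \<subseteq> F' \<longleftrightarrow> f F \<subseteq> f F')))"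

text \<open>
  As in the library, the dimension \<open>k\<close> of a simplex ranges over \<open>-1, 0, 1, \<dots>\<close>, and the empty
  polytope is the simplex of dimension \<open>-1\<close>. The comparison simplex may be taken in the ambient
  space of \<open>P\<close>, which contains simplices of every dimension up to its own.
\<close>

definition comb_simplex :: "'a::euclidean_space set \<Rightarrow> bool" where
  "comb_simplex P \<longleftrightarrow> (\<exists>k (S :: 'a set). k simplex S \<and> comb_equiv P S)"

text \<open>
  The submatrix \<open>A'\<close> of the columns with index in \<open>I\<close>, for \<open>I = supp_index A\<close>: its rank is the
  dimension of its column space, and its kernel, a subspace of \<open>\<real>\<^sup>I\<close>, is regarded as a
  subspace of \<open>coord_subspace I\<close>.
\<close>

definition sub_rank :: "int^'n^'l \<Rightarrow> nat" where
  "sub_rank A = dim ((\<lambda>j. column j (map_matrix real_of_int A)) ` supp_index A)"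

definition sub_ker :: "int^'n^'l \<Rightarrow> (real^'n) set" where
  "sub_ker A = {x \<in> coord_subspace (supp_index A).
                  \<forall>i. (\<Sum>j \<in> supp_index A. real_of_int (A $ i $ j) * x $ j) = 0}"

text \<open>
  \<open>A'\<close> as an honest \<open>\<ell> \<times> |I|\<close> matrix, its rows listed by \<open>\<rho>\<close> and its columns listed by \<open>\<sigma>\<close>.
  Permuting the indices in \<open>I\<close> is choosing another \<open>\<sigma>\<close>.
\<close>

definition submat ::
    "int^'n^'l \<Rightarrow> (nat \<Rightarrow> 'l) \<Rightarrow> (nat \<Rightarrow> 'n) \<Rightarrow> int Matrix.mat" where
  "submat A \<rho> \<sigma> = Matrix.mat (CARD('l)) (card (supp_index A)) (\<lambda>(i, k). A $ \<rho> i $ \<sigma> k)"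

inductive int_row_op :: "int Matrix.mat \<Rightarrow> int Matrix.mat \<Rightarrow> bool" where
  swap: "k < dim_row M \<Longrightarrow> l < dim_row M \<Longrightarrow> int_row_op M (swaprows k l M)"
| scale: "k < dim_row M \<Longrightarrow> a \<noteq> 0 \<Longrightarrow> int_row_op M (multrow k a M)"
| add: "k < dim_row M \<Longrightarrow> l < dim_row M \<Longrightarrow> k \<noteq> l \<Longrightarrow> int_row_op M (addrow a k l M)"

text \<open>
  The block matrix \<open>[D | C 0; 0 | 0 0]\<close> with \<open>m\<close> rows and \<open>s\<close> columns, where \<open>D\<close> is \<open>r \<times> r\<close>
  and \<open>C\<close> is \<open>r \<times> q\<close>.
\<close>

definition block_form ::
    "nat \<Rightarrow> nat \<Rightarrow> nat \<Rightarrow> nat \<Rightarrow> int Matrix.mat \<Rightarrow> int Matrix.mat \<Rightarrow> int Matrix.mat" where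
  "block_form m s r q D C =
     four_block_mat D (four_block_mat C (0\<^sub>m r (s - r - q)) (0\<^sub>m 0 q) (0\<^sub>m 0 (s - r - q)))
       (0\<^sub>m (m - r) r) (0\<^sub>m (m - r) (s - r))"

text \<open>The choice of \<open>\<rho>\<close> is immaterial, since row swaps are among the row operations.\<close>

definition reducible_to_block_form :: "int^'n^'l \<Rightarrow> nat \<Rightarrow> bool" where
  "reducible_to_block_form A r \<longleftrightarrow>
     (\<exists>\<rho> \<sigma> q D C.
        bij_betw \<rho> {..<CARD('l)} UNIV \<and>
        bij_betw \<sigma> {..<card (supp_index A)} (supp_index A) \<and>
        q \<le> card (supp_index A) - r \<and>
        D \<in> carrier_mat r r \<and> diagonal_mat D \<and> (\<forall>i<r. D $$ (i, i) < 0) \<and>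
        C \<in> carrier_mat r q \<and> (\<forall>i<r. \<forall>k<q. 0 \<le> C $$ (i, k)) \<and>
        int_row_op\<^sup>*\<^sup>* (submat A \<rho> \<sigma>) (block_form (CARD('l)) (card (supp_index A)) r q D C))"

definition has_normal_vectors :: "int^'n^'l \<Rightarrow> nat \<Rightarrow> bool" where
  "has_normal_vectors A r \<longleftrightarrow>
     (\<exists>(\<mu> :: nat \<Rightarrow> real^'n) (j :: nat \<Rightarrow> 'n).
        (\<forall>i<r. \<mu> i \<in> coord_subspace (supp_index A) \<and> j i \<in> supp_index A) \<and>
        sub_ker A = coord_subspace (supp_index A) \<inter> (\<Inter>i<r. orthogonal_comp {\<mu> i}) \<and>
        (\<forall>i<r.
           axis (j i) 1 \<bullet> \<mu> i < 0 \<and>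
           (\<forall>k<r. k \<noteq> i \<longrightarrow> axis (j k) 1 \<bullet> \<mu> i = 0) \<and>
           (\<forall>h \<in> supp_index A. h \<noteq> j i \<longrightarrow> axis h 1 \<bullet> \<mu> i \<ge> 0)))"

text \<open>
  The number \<open>r\<close> of pivots in the last two conditions is necessarily the rank of \<open>A'\<close>, and this
  can be smaller than the rank of \<open>A\<close>: for \<open>A\<close> with rows \<open>(-1, 1, 0)\<close> and \<open>(0, 0, 1)\<close>, of rank 2,
  the polytope is the single point \<open>(1/2, 1/2, 0)\<close> and \<open>A'\<close> has rows \<open>(-1, 1)\<close> and \<open>(0, 0)\<close>, of
  rank 1. The two conditions are therefore to be taken at \<open>r = sub_rank A\<close>, which is the rank of
  \<open>A\<close> whenever the two ranks agree, for instance when \<open>supp_index A\<close> is everything.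
\<close>

end

theory Submission
  imports Defs
begin

text \<open>
  All three conditions are compared with one statement about the kernel of \<open>A'\<close>, called a
  nonnegative kernel form below: the index set \<open>I\<close> splits into a set \<open>J\<close> of dependent and a set
  \<open>I - J\<close> of free coordinates such that \<open>ker A'\<close> is the graph
  \<open>x\<^sub>j = \<Sum>\<^sub>k c\<^sub>j\<^sub>k x\<^sub>k\<close> (\<open>j \<in> J\<close>, \<open>k \<in> I - J\<close>) of a linear map with nonnegative
  coefficients. Then the columns in \<open>J\<close> are a basis of the column space, so \<open>J\<close> has as many
  elements as the rank of \<open>A'\<close>.

  Geometry. A nonnegative kernel form provides, for each free \<open>k\<close>, a nonnegative kernel vector
  with \<open>k\<close>-th coordinate 1 and all other free coordinates 0. After normalization these vectors are
  affinely independent and their convex hull is \<open>\<P>\<^sub>A\<close>, which is thus a simplex. Conversely, in a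
  combinatorial simplex every vertex \<open>v\<close> has an opposite face, which contains all other vertices
  (\<open>comb_simplex_face_opposite_vertex\<close>), and a face of \<open>\<P>\<^sub>A\<close> which misses \<open>v\<close> lies in a
  coordinate hyperplane which misses \<open>v\<close> (\<open>face_vanishing_coordinate\<close>). So every vertex \<open>v\<close> has a
  coordinate \<open>h v\<close> that is positive at \<open>v\<close> and zero at the other
  vertices. Therefore the coordinates \<open>x\<^bsub>h v\<^esub>\<close> of a point \<open>x\<close> determine its coefficients in a
  combination of the vertices, and the resulting formula for \<open>x\<close> has nonnegative coefficients. It
  is linear in \<open>x\<close> and extends from \<open>\<P>\<^sub>A\<close> to \<open>ker A'\<close>, because \<open>\<P>\<^sub>A\<close>, unless it is
  empty, contains a point that is positive on all of \<open>I\<close> (\<open>polytope_spans_sub_ker\<close>).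

  Algebra. Row operations preserve the kernel, so that the nonzero rows of the block matrix are
  normal vectors of the required shape. Solving the equation given by a normal vector \<open>\<mu>\<^sub>i\<close> for
  the coordinate with index \<open>j\<^sub>i\<close> yields a nonnegative kernel form. If a nonnegative kernel form is
  given and the columns in \<open>J\<close> are placed first, no nonzero kernel vector is supported on them, hence
  elimination without division finds a pivot in each of them (\<open>int_row_ops_diagonalize\<close>). The kernel
  then forces the entries of the remaining columns (\<open>int_row_ops_to_block_form\<close>).

  If \<open>n \<le> r + 2\<close> for the rank \<open>r\<close> of \<open>A\<close>, then \<open>\<P>\<^sub>A\<close> lies in a space of dimension at most 2 and
  there in a line that avoids the origin, so it is empty, a point or a segment.
\<close>

section \<open>Integer row operations\<close>

definition solutions :: "int Matrix.mat \<Rightarrow> (nat \<Rightarrow> real) set" where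
  "solutions M = {x. \<forall>i<dim_row M. (\<Sum>k<dim_col M. real_of_int (M $$ (i, k)) * x k) = 0}"

lemma int_row_op_dim:
  assumes "int_row_op M N"
  shows "dim_row N = dim_row M" "dim_col N = dim_col M"
  using assms by (auto elim!: int_row_op.cases simp: mat_swaprows_def mat_multrow_def mat_addrow_def)

lemma int_row_ops_dim:
  assumes "int_row_op\<^sup>*\<^sup>* M N"
  shows "dim_row N = dim_row M" "dim_col N = dim_col M"
  using assms by (induction rule: rtranclp_induct) (auto simp: int_row_op_dim)

lemma int_row_op_solutions:
  assumes "int_row_op M N"
  shows "solutions N = solutions M"
proof -
  define L where "L M' x i = (\<Sum>k<dim_col M. real_of_int (M' $$ (i, k)) * x k)"
    for M' :: "int Matrix.mat" and x :: "nat \<Rightarrow> real" and i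
  have "(\<forall>i<dim_row M. L N x i = 0) \<longleftrightarrow> (\<forall>i<dim_row M. L M x i = 0)" for x
    using assms
  proof cases
    case (swap k l)
    then have "L N x i = L M x (if k = i then l else if l = i then k else i)"
      if "i < dim_row M" for i
      using that by (auto simp: L_def mat_swaprows_def intro!: sum.cong)
    then show ?thesis using swap by (metis (full_types))
  next
    case (scale k a)
    then have "L N x i = (if k = i then a * L M x i else L M x i)" if "i < dim_row M" for i
      using that by (auto simp: L_def mat_multrow_def sum_distrib_left ac_simps intro!: sum.cong)
    then show ?thesis using scale by auto
  next
    case (add k l a)
    then have eq: "L N x i = (if k = i then a * L M x l else 0) + L M x i" if "i < dim_row M" for i
      using that by (auto simp: L_def mat_addrow_def sum_distrib_left sum.distrib[symmetric]
          algebra_simps intro!: sum.cong)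
    show ?thesis
    proof
      assume zero: "\<forall>i<dim_row M. L N x i = 0"
      then have "L M x l = 0" using eq[of l] add by simp
      then have "L N x i = L M x i" if "i < dim_row M" for i using eq[OF that] by simp
      then show "\<forall>i<dim_row M. L M x i = 0" using zero by simp
    qed (use eq add in simp)
  qed
  then show ?thesis
    using int_row_op_dim[OF assms] by (simp add: solutions_def L_def)
qed

lemma int_row_ops_solutions:
  assumes "int_row_op\<^sup>*\<^sup>* M N"
  shows "solutions N = solutions M"
  using assms by (induction rule: rtranclp_induct) (auto simp: int_row_op_solutions)

text \<open>
  Elimination must not divide, so each of the other rows is scaled by the pivot before a multiple of
  the pivot row is added. As the pivot is negative, scaling by its negative keeps the signs of the
  pivots that were produced earlier.
\<close>

lemma int_row_ops_clear_column:
  fixes M :: "int Matrix.mat"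
  assumes t: "t < dim_row M" "t < dim_col M" and neg: "M $$ (t, t) < 0"
  shows "\<exists>N. int_row_op\<^sup>*\<^sup>* M N \<and>
    (\<forall>i<dim_row M. \<forall>k<dim_col M. N $$ (i, k) =
       (if i = t then M $$ (i, k)
        else M $$ (i, t) * M $$ (t, k) - M $$ (t, t) * M $$ (i, k)))"
proof -
  \<comment> \<open>The rows are treated one after the other; \<open>u\<close> counts those that have been visited.\<close>
  have "\<exists>N. int_row_op\<^sup>*\<^sup>* M N \<and>
    (\<forall>i<dim_row M. \<forall>k<dim_col M. N $$ (i, k) =
       (if i = t \<or> u \<le> i then M $$ (i, k)
        else M $$ (i, t) * M $$ (t, k) - M $$ (t, t) * M $$ (i, k)))"
    if "u \<le> dim_row M" for u
    using that
  proof (induction u)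
    case 0
    show ?case by (rule exI[of _ M]) auto
  next
    case (Suc u)
    then obtain N where N: "int_row_op\<^sup>*\<^sup>* M N"
      and Nv: "\<And>i k. i < dim_row M \<Longrightarrow> k < dim_col M \<Longrightarrow> N $$ (i, k) =
       (if i = t \<or> u \<le> i then M $$ (i, k)
        else M $$ (i, t) * M $$ (t, k) - M $$ (t, t) * M $$ (i, k))"
      by (metis Suc_leD)
    note dims = int_row_ops_dim[OF N]
    show ?case
    proof (cases "u = t")
      case True
      then show ?thesis using N Nv by (intro exI[of _ N]) (auto simp: le_Suc_eq not_less_eq_eq)
    next
      case False
      define N1 where "N1 = multrow u (- M $$ (t, t)) N"
      define N2 where "N2 = addrow (M $$ (u, t)) u t N1"
      have u: "u < dim_row M" using Suc.prems by simp
      have "int_row_op N N1"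
        unfolding N1_def using u neg dims by (intro int_row_op.scale) auto
      moreover have "int_row_op N1 N2"
        unfolding N2_def using u t False dims int_row_op_dim[OF calculation]
        by (intro int_row_op.add) auto
      ultimately have "int_row_op\<^sup>*\<^sup>* M N2" using N by auto
      moreover have "N2 $$ (i, k) =
         (if i = t \<or> Suc u \<le> i then M $$ (i, k)
          else M $$ (i, t) * M $$ (t, k) - M $$ (t, t) * M $$ (i, k))"
        if "i < dim_row M" "k < dim_col M" for i k
        using that t False u dims
        by (auto simp: N2_def N1_def mat_addrow_def mat_multrow_def Nv)
      ultimately show ?thesis by blast
    qed
  qed
  from this[of "dim_row M"] show ?thesis by (auto cong: conj_cong)
qed

text \<open>
  A column without a pivot would, together with the pivots to its left, yield a nonzero kernel vector
  supported on the first \<open>r\<close> coordinates.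
\<close>

lemma int_row_ops_diagonalize:
  fixes M :: "int Matrix.mat"
  assumes r: "r \<le> dim_col M"
    and indep: "\<And>x k. x \<in> solutions M \<Longrightarrow> (\<And>h. r \<le> h \<Longrightarrow> x h = 0) \<Longrightarrow> k < r \<Longrightarrow> x k = 0"
    and "t \<le> r"
  shows "\<exists>N. int_row_op\<^sup>*\<^sup>* M N \<and> t \<le> dim_row M \<and> (\<forall>k<t. N $$ (k, k) < 0) \<and>
    (\<forall>i<dim_row M. \<forall>k<t. i \<noteq> k \<longrightarrow> N $$ (i, k) = 0)"
  using \<open>t \<le> r\<close>
proof (induction t)
  case 0
  then show ?case by blast
next
  case (Suc t)
  then obtain N where N: "int_row_op\<^sup>*\<^sup>* M N" and tm: "t \<le> dim_row M"
    and diag: "\<And>k. k < t \<Longrightarrow> N $$ (k, k) < 0"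
    and off: "\<And>i k. i < dim_row M \<Longrightarrow> k < t \<Longrightarrow> i \<noteq> k \<Longrightarrow> N $$ (i, k) = 0"
    by (metis Suc_leD)
  note dims = int_row_ops_dim[OF N]
  have tc: "t < dim_col M" using Suc.prems r by simp
  obtain p where p: "t \<le> p" "p < dim_row M" "N $$ (p, t) \<noteq> 0"
  proof (rule ccontr)
    assume "\<not> thesis"
    with that have zero: "N $$ (i, t) = 0" if "t \<le> i" "i < dim_row M" for i using that by blast
    \<comment> \<open>Column \<open>t\<close> is a combination of the columns with a pivot; \<open>x\<close> is this relation.\<close>
    define x where "x k = (if k = t then 1 else if k < t
      then - real_of_int (N $$ (k, t)) / real_of_int (N $$ (k, k)) else 0)" for k
    have "x \<in> solutions N"
      unfolding solutions_def
    proof (intro CollectI allI impI)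
      fix i assume i: "i < dim_row N"
      have "(\<Sum>k<dim_col N. real_of_int (N $$ (i, k)) * x k)
        = (\<Sum>k\<in>{t} \<union> ({i} \<inter> {..<t}). real_of_int (N $$ (i, k)) * x k)"
        using tc dims off i by (intro sum.mono_neutral_right) (auto simp: x_def)
      also have "\<dots> = 0"
        using diag[of i] zero[of i] i dims by (cases "i < t") (auto simp: x_def)
      finally show "(\<Sum>k<dim_col N. real_of_int (N $$ (i, k)) * x k) = 0" .
    qed
    then have "x t = 0"
      using indep[of x t] int_row_ops_solutions[OF N] Suc.prems by (auto simp: x_def)
    then show False by (simp add: x_def)
  qed
  define N1 where "N1 = swaprows t p N"
  have op1: "int_row_op N N1"
    unfolding N1_def using p dims by (intro int_row_op.swap) auto
  \<comment> \<open>The factor makes the new pivot negative.\<close>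
  define N2 where "N2 = multrow t (- sgn (N $$ (p, t))) N1"
  have op2: "int_row_op N1 N2"
    unfolding N2_def using p dims int_row_op_dim[OF op1]
    by (intro int_row_op.scale) (auto simp: sgn_if)
  have dims2: "dim_row N2 = dim_row M" "dim_col N2 = dim_col M"
    using dims int_row_op_dim[OF op1] int_row_op_dim[OF op2] by auto
  have N2: "N2 $$ (i, k) = (if i = t then - sgn (N $$ (p, t)) * N $$ (p, k)
      else if i = p then N $$ (t, k) else N $$ (i, k))"
    if "i < dim_row M" "k < dim_col M" for i k
    using that p dims by (auto simp: N2_def N1_def mat_multrow_def mat_swaprows_def)
  have N2tt: "N2 $$ (t, t) < 0"
    using p tc by (subst N2) (auto simp: sgn_if)
  obtain N3 where N3: "int_row_op\<^sup>*\<^sup>* N2 N3" "\<And>i k. i < dim_row M \<Longrightarrow> k < dim_col M \<Longrightarrow> N3 $$ (i, k) =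
       (if i = t then N2 $$ (i, k)
        else N2 $$ (i, t) * N2 $$ (t, k) - N2 $$ (t, t) * N2 $$ (i, k))"
    using int_row_ops_clear_column[of t N2] N2tt p tc dims2 by auto
  have "int_row_op\<^sup>*\<^sup>* M N3"
    using N op1 op2 N3(1) by (meson rtranclp.rtrancl_into_rtrancl rtranclp_trans)
  moreover have "N3 $$ (k, k) < 0" if "k < Suc t" for k
  proof (cases "k = t")
    case True
    then show ?thesis using N3(2)[of t t] p tc N2tt by auto
  next
    case False
    then have "N3 $$ (k, k) = - (N2 $$ (t, t) * N $$ (k, k))"
      using that p tc by (auto simp: N3(2) N2 off)
    then show ?thesis
      using N2tt diag[of k] False that by (simp add: mult_neg_neg)
  qed
  moreover have "N3 $$ (i, k) = 0" if "k < Suc t" "i < dim_row M" "i \<noteq> k" for i k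
  proof (cases "k = t")
    case True
    then show ?thesis using that tc by (auto simp: N3(2))
  next
    case False
    then show ?thesis using that p tc by (auto simp: N3(2) N2 off)
  qed
  ultimately show ?case using p by (intro exI[of _ N3]) auto
qed

lemma block_form_dim:
  assumes "D \<in> carrier_mat r r" "C \<in> carrier_mat r q" "q \<le> s - r" "r \<le> m" "r \<le> s"
  shows "dim_row (block_form m s r q D C) = m" "dim_col (block_form m s r q D C) = s"
  using assms by (auto simp: block_form_def)

lemma block_form_index:
  assumes "D \<in> carrier_mat r r" "C \<in> carrier_mat r q" "q \<le> s - r" "r \<le> m" "r \<le> s"
    and "i < m" "k < s"
  shows "block_form m s r q D C $$ (i, k) =
    (if i < r then if k < r then D $$ (i, k) else if k < r + q then C $$ (i, k - r) else 0 else 0)"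
  using assms by (auto simp: block_form_def)

text \<open>
  The first \<open>r\<close> columns are diagonalized first. For the remaining columns, each free coordinate
  \<open>k\<close> gives the kernel vector with entries \<open>c i k\<close> on the dependent coordinates, and orthogonality to
  it determines the entries in column \<open>k\<close>: they are nonnegative in the pivot rows, as the pivots are
  negative, and zero below.
\<close>

lemma int_row_ops_to_block_form:
  fixes M :: "int Matrix.mat" and c :: "nat \<Rightarrow> nat \<Rightarrow> real"
  assumes r: "r \<le> dim_col M"
    and nonneg: "\<And>i k. i < r \<Longrightarrow> r \<le> k \<Longrightarrow> k < dim_col M \<Longrightarrow> 0 \<le> c i k"
    and sol: "solutions M = {x. \<forall>i<r. x i = (\<Sum>k=r..<dim_col M. c i k * x k)}"
  shows "\<exists>D C. D \<in> carrier_mat r r \<and> diagonal_mat D \<and> (\<forall>i<r. D $$ (i, i) < 0) \<and>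
    C \<in> carrier_mat r (dim_col M - r) \<and> (\<forall>i<r. \<forall>k<dim_col M - r. 0 \<le> C $$ (i, k)) \<and>
    int_row_op\<^sup>*\<^sup>* M (block_form (dim_row M) (dim_col M) r (dim_col M - r) D C)"
proof -
  define m s where "m = dim_row M" and "s = dim_col M"
  have "\<exists>N. int_row_op\<^sup>*\<^sup>* M N \<and> r \<le> dim_row M \<and> (\<forall>k<r. N $$ (k, k) < 0) \<and>
    (\<forall>i<dim_row M. \<forall>k<r. i \<noteq> k \<longrightarrow> N $$ (i, k) = 0)"
    by (rule int_row_ops_diagonalize[OF r]) (auto simp: sol)
  then obtain N where N: "int_row_op\<^sup>*\<^sup>* M N" and rm: "r \<le> m"
    and diag: "\<And>k. k < r \<Longrightarrow> N $$ (k, k) < 0"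
    and off: "\<And>i k. i < m \<Longrightarrow> k < r \<Longrightarrow> i \<noteq> k \<Longrightarrow> N $$ (i, k) = 0"
    unfolding m_def by blast
  note dims = int_row_ops_dim[OF N, folded m_def s_def]
  have rs: "r \<le> s" using r by (simp add: s_def)
  have entry: "real_of_int (N $$ (i, k)) = (if i < r then - real_of_int (N $$ (i, i)) * c i k else 0)"
    if i: "i < m" and k: "r \<le> k" "k < s" for i k
  proof -
    define x where "x h = (if h < r then c h k else if h = k then 1 else 0)" for h
    have "(\<Sum>h=r..<s. c j h * x h) = c j k" for j
    proof -
      have "(\<Sum>h=r..<s. c j h * x h) = (\<Sum>h\<in>{k}. c j h * x h)"
        using k by (intro sum.mono_neutral_right) (auto simp: x_def)
      then show ?thesis using k by (simp add: x_def)
    qed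
    then have "x \<in> solutions N"
      using int_row_ops_solutions[OF N] by (auto simp: sol s_def[symmetric] x_def)
    then have "0 = (\<Sum>h<s. real_of_int (N $$ (i, h)) * x h)"
      using i dims by (simp add: solutions_def)
    also have "\<dots> = (\<Sum>h\<in>{k} \<union> ({i} \<inter> {..<r}). real_of_int (N $$ (i, h)) * x h)"
      using k rs off i by (intro sum.mono_neutral_right) (auto simp: x_def)
    also have "\<dots> = real_of_int (N $$ (i, k)) +
        (if i < r then real_of_int (N $$ (i, i)) * c i k else 0)"
      using k by (auto simp: x_def)
    finally show ?thesis by (auto split: if_splits)
  qed
  define D where "D = Matrix.mat r r (\<lambda>(i, k). N $$ (i, k))"
  define C where "C = Matrix.mat r (s - r) (\<lambda>(i, k). N $$ (i, r + k))"
  have DC: "D \<in> carrier_mat r r" "C \<in> carrier_mat r (s - r)" by (auto simp: D_def C_def)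
  have "N = block_form m s r (s - r) D C"
  proof (rule eq_matI)
    fix i k assume "i < dim_row (block_form m s r (s - r) D C)"
      "k < dim_col (block_form m s r (s - r) D C)"
    then have ik: "i < m" "k < s" using block_form_dim[OF DC] rm rs by auto
    then show "N $$ (i, k) = block_form m s r (s - r) D C $$ (i, k)"
      using block_form_index[OF DC _ rm rs ik] entry[of i k] off[of i k]
      by (cases "k < r") (auto simp: D_def C_def)
  qed (use dims block_form_dim[OF DC] rm rs in auto)
  moreover have "0 \<le> C $$ (i, k)" if "i < r" "k < s - r" for i k
  proof -
    have "real_of_int (C $$ (i, k)) = - real_of_int (N $$ (i, i)) * c i (r + k)"
      using that entry[of i "r + k"] rm by (auto simp: C_def)
    also have "\<dots> \<ge> 0"
      using diag[of i] nonneg[of i "r + k"] that by (intro mult_nonneg_nonneg) (auto simp: s_def)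
    finally show ?thesis by simp
  qed
  moreover have "diagonal_mat D" "\<forall>i<r. D $$ (i, i) < 0"
    using rm off diag by (auto simp: D_def diagonal_mat_def)
  ultimately show ?thesis
    using N DC by (intro exI[of _ D] exI[of _ C]) (auto simp: m_def s_def)
qed

section \<open>The polytope and the kernel of the submatrix\<close>

lemma sum_eq_single:
  assumes "finite A" "a \<in> A" "\<And>x. x \<in> A \<Longrightarrow> x \<noteq> a \<Longrightarrow> f x = 0"
  shows "sum f A = f a"
  using assms by (simp add: sum.remove sum.neutral)

lemma mem_std_simplex:
  "x \<in> std_simplex \<longleftrightarrow> (\<forall>j. 0 \<le> x $ j) \<and> (\<Sum>j\<in>UNIV. x $ j) = 1"
proof
  have "convex {x::real^'n. (\<forall>j. 0 \<le> x $ j) \<and> (\<Sum>j\<in>UNIV. x $ j) = 1}"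
    by (auto simp: convex_def sum.distrib sum_distrib_left[symmetric])
  then have "std_simplex \<subseteq> {x::real^'n. (\<forall>j. 0 \<le> x $ j) \<and> (\<Sum>j\<in>UNIV. x $ j) = 1}"
    unfolding std_simplex_def by (intro hull_minimal) (auto simp: axis_def)
  then show "(\<forall>j. 0 \<le> x $ j) \<and> (\<Sum>j\<in>UNIV. x $ j) = 1" if "x \<in> std_simplex"
    using that by auto
  have "(\<Sum>j\<in>UNIV. x $ j *\<^sub>R axis j 1) \<in> std_simplex"
    if "(\<forall>j. 0 \<le> x $ j) \<and> (\<Sum>j\<in>UNIV. x $ j) = 1"
    using that unfolding std_simplex_def by (intro convex_sum) (auto intro: hull_inc)
  moreover have "(\<Sum>j\<in>UNIV. x $ j *\<^sub>R axis j 1) = x"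
    using basis_expansion[of x] by (simp add: scalar_mult_eq_scaleR)
  ultimately show "x \<in> std_simplex" if "(\<forall>j. 0 \<le> x $ j) \<and> (\<Sum>j\<in>UNIV. x $ j) = 1"
    using that by simp
qed

lemma mem_sub_ker:
  "x \<in> sub_ker A \<longleftrightarrow> x \<in> coord_subspace (supp_index A) \<and> map_matrix real_of_int A *v x = 0"
proof -
  have "(\<Sum>j\<in>supp_index A. real_of_int (A $ i $ j) * x $ j) = (map_matrix real_of_int A *v x) $ i"
    if "x \<in> coord_subspace (supp_index A)" for i
    using that by (auto simp: matrix_vector_mult_def coord_subspace_def intro!: sum.mono_neutral_left)
  then show ?thesis by (auto simp: sub_ker_def vec_eq_iff)
qed

lemma subspace_sub_ker: "subspace (sub_ker A)"
  by (auto simp: subspace_def mem_sub_ker coord_subspace_def matrix_vector_right_distrib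
      matrix_vector_mult_scaleR)

lemma mem_polytope_of:
  "x \<in> polytope_of A \<longleftrightarrow> x \<in> sub_ker A \<and> (\<forall>j. 0 \<le> x $ j) \<and> (\<Sum>j\<in>UNIV. x $ j) = 1"
  by (auto simp: mem_sub_ker polytope_of_def mem_std_simplex coord_subspace_def supp_index_def)

lemma polytope_polytope_of: "polytope (polytope_of A)"
proof -
  have "subspace {x. map_matrix real_of_int A *v x = 0}"
    by (auto simp: subspace_def matrix_vector_right_distrib matrix_vector_mult_scaleR)
  then have "polyhedron {x. map_matrix real_of_int A *v x = 0}"
    by (intro affine_imp_polyhedron subspace_imp_affine)
  moreover have "polytope (std_simplex :: (real^'n) set)"
    unfolding std_simplex_def by (intro polytope_convex_hull) auto
  ultimately show ?thesis
    unfolding polytope_of_def by (metis Int_commute polytope_Int_polyhedron)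
qed

text \<open>
  The average of one witness for each coordinate in \<open>T\<close> is positive at all of them.
\<close>

lemma convex_point_positive_on:
  fixes F :: "(real^'n) set"
  assumes "convex F" and nonneg: "\<And>x j. x \<in> F \<Longrightarrow> 0 \<le> x $ j"
    and "T \<noteq> {}" and "\<And>j. j \<in> T \<Longrightarrow> \<exists>x\<in>F. x $ j \<noteq> 0"
  obtains p where "p \<in> F" "\<And>j. j \<in> T \<Longrightarrow> 0 < p $ j"
proof -
  from assms(4) obtain y where y: "\<And>j. j \<in> T \<Longrightarrow> y j \<in> F \<and> y j $ j \<noteq> 0" by metis
  have fin: "finite T" by simp
  define p where "p = (\<Sum>j\<in>T. (1 / real (card T)) *\<^sub>R y j)"
  have "p \<in> F"
    unfolding p_def using assms(1,3) y fin by (intro convex_sum) auto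
  moreover have "0 < p $ j" if "j \<in> T" for j
  proof -
    have "0 < (\<Sum>i\<in>T. y i $ j)"
    proof (rule sum_pos2[OF fin that])
      show "0 < y j $ j" using y[OF that] nonneg[of "y j" j] by simp
    qed (use y nonneg in auto)
    moreover have "p $ j = (\<Sum>i\<in>T. y i $ j) / real (card T)"
      by (simp add: p_def sum_divide_distrib)
    ultimately show ?thesis using fin assms(3) by (simp add: card_gt_0_iff)
  qed
  ultimately show thesis using that by blast
qed

text \<open>
  If each coordinate in the support of \<open>v\<close> were nonzero somewhere on \<open>F\<close>, then \<open>F\<close> would contain a
  point \<open>p\<close> that is positive on this support. The segment from \<open>v\<close> to \<open>p\<close> could then be prolonged
  beyond \<open>p\<close> inside the polytope, which forces the face \<open>F\<close> to contain \<open>v\<close>.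
\<close>

lemma face_vanishing_coordinate:
  assumes F: "F face_of polytope_of A" and v: "v \<in> polytope_of A" "v \<notin> F"
  obtains j where "0 < v $ j" "\<And>x. x \<in> F \<Longrightarrow> x $ j = 0"
proof (rule ccontr)
  assume contra: "\<not> thesis"
  note found = that
  have *: "\<exists>x\<in>F. x $ j \<noteq> 0" if "j \<in> {j. 0 < v $ j}" for j
  proof (rule ccontr)
    assume "\<not> (\<exists>x\<in>F. x $ j \<noteq> 0)"
    then show False using found[of j] contra that by auto
  qed
  have FP: "F \<subseteq> polytope_of A" "convex F"
    using F by (auto simp: face_of_imp_subset face_of_imp_convex)
  have "{j. 0 < v $ j} \<noteq> {}"
  proof
    assume "{j. 0 < v $ j} = {}"
    then have "(\<Sum>j\<in>UNIV. v $ j) \<le> 0" by (intro sum_nonpos) (auto simp: not_less)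
    then show False using v by (simp add: mem_polytope_of)
  qed
  moreover have "0 \<le> x $ j" if "x \<in> F" for x j
    using FP(1) that by (auto simp: mem_polytope_of)
  ultimately obtain p where "p \<in> F" "\<And>j. j \<in> {j. 0 < v $ j} \<Longrightarrow> 0 < p $ j"
    using convex_point_positive_on[OF FP(2), of "{j. 0 < v $ j}"] * by metis
  then have p: "p \<in> F" "\<And>j. 0 < v $ j \<Longrightarrow> 0 < p $ j" by auto
  have pP: "p \<in> polytope_of A" using p FP by auto
  obtain e where e: "0 < e" "\<And>j. 0 \<le> p $ j + e * (p $ j - v $ j)"
  proof -
    \<comment> \<open>As \<open>v $ j \<le> 1\<close>, this gives \<open>e * v $ j \<le> p $ j\<close> on the support of \<open>v\<close>.\<close>
    define e where "e = Min (insert 1 ((\<lambda>j. p $ j) ` {j. 0 < v $ j}))"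
    have "0 < e" using p by (auto simp: e_def)
    moreover have "0 \<le> p $ j + e * (p $ j - v $ j)" for j
    proof (cases "0 < v $ j")
      case True
      then have "e \<le> p $ j" by (auto simp: e_def)
      have "v $ j \<le> (\<Sum>i\<in>UNIV. v $ i)"
        using v by (intro member_le_sum) (auto simp: mem_polytope_of)
      also have "\<dots> = 1" using v by (simp add: mem_polytope_of)
      finally have "e * v $ j \<le> e" using \<open>0 < e\<close> by simp
      moreover have "0 \<le> e * p $ j" using \<open>0 < e\<close> p(2)[OF True] by simp
      ultimately show ?thesis using \<open>e \<le> p $ j\<close> by (simp add: algebra_simps)
    next
      case False
      then have "v $ j = 0" using v by (auto simp: mem_polytope_of not_less antisym)
      moreover have "0 \<le> p $ j" using pP by (simp add: mem_polytope_of)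
      ultimately show ?thesis using \<open>0 < e\<close> by simp
    qed
    ultimately show thesis using that by blast
  qed
  define q where "q = p + e *\<^sub>R (p - v)"
  have "q \<in> sub_ker A"
    unfolding q_def using pP v
    by (intro subspace_add subspace_mul subspace_diff subspace_sub_ker) (auto simp: mem_polytope_of)
  then have "q \<in> polytope_of A"
    using pP v e by (simp add: mem_polytope_of q_def sum.distrib sum_subtractf sum_distrib_left[symmetric])
  moreover have "p \<in> open_segment v q"
  proof -
    have "(1 / (1 + e)) *\<^sub>R q = (1 / (1 + e)) *\<^sub>R ((1 + e) *\<^sub>R p - e *\<^sub>R v)"
      by (simp add: q_def algebra_simps)
    also have "\<dots> = p - (e / (1 + e)) *\<^sub>R v" using e(1) by (simp add: scaleR_diff_right)
    also have "e / (1 + e) = 1 - 1 / (1 + e)" using e(1) by (simp add: field_simps)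
    finally have "p = (1 - 1 / (1 + e)) *\<^sub>R v + (1 / (1 + e)) *\<^sub>R q" by simp
    moreover have "v \<noteq> q"
    proof
      assume "v = q"
      then have "(1 + e) *\<^sub>R (p - v) = 0" by (simp add: q_def algebra_simps)
      then show False using e(1) p(1) v(2) by auto
    qed
    ultimately show ?thesis
      unfolding in_segment
    proof (intro conjI exI[of _ "1 / (1 + e)"])
      show "0 < 1 / (1 + e)" "1 / (1 + e) < 1" using e(1) by auto
    qed
  qed
  ultimately have "v \<in> F" using F v(1) p(1) unfolding face_of_def by blast
  then show False using v(2) by simp
qed

text \<open>
  An isomorphism \<open>f\<close> of the face lattices fixes the empty face, so it sends vertices to vertices:
  the image of a vertex is a nonempty face and hence has a vertex of its own, whose preimage is a
  nonempty subface of the given vertex. In a genuine simplex the other vertices span a face that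
  misses the given one, and this face is pulled back along \<open>f\<close>.
\<close>

lemma comb_simplex_face_opposite_vertex:
  fixes P :: "'a::euclidean_space set"
  assumes "comb_simplex P" and v: "v extreme_point_of P"
  obtains F where "F face_of P" "v \<notin> F" "\<And>w. w extreme_point_of P \<Longrightarrow> w \<noteq> v \<Longrightarrow> w \<in> F"
proof -
  from assms(1) obtain n and S :: "'a set" and f where "n simplex S"
    and bij: "bij_betw f {F. F face_of P} {G. G face_of S}"
    and mono: "\<And>F F'. F face_of P \<Longrightarrow> F' face_of P \<Longrightarrow> F \<subseteq> F' \<longleftrightarrow> f F \<subseteq> f F'"
    unfolding comb_simplex_def comb_equiv_def by blast
  then obtain C where C: "\<not> affine_dependent C" and S: "S = convex hull C"
    unfolding simplex_def by blast
  have face: "f F face_of S" if "F face_of P" for F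
    using bij that unfolding bij_betw_def by blast
  have lift: "\<exists>F. F face_of P \<and> f F = G" if "G face_of S" for G
    using bij that unfolding bij_betw_def by (metis (mono_tags) imageE mem_Collect_eq)
  have inj: "F = F'" if "F face_of P" "F' face_of P" "f F = f F'" for F F'
    using mono that by (metis subset_antisym subset_refl)
  have f_empty: "f {} = {}"
  proof -
    obtain F where F: "F face_of P" "f F = {}" using lift[of "{}"] by auto
    then show ?thesis using mono[of "{}" F] by simp
  qed
  have vertex: "\<exists>g\<in>C. f {w} = {g}" if w: "w extreme_point_of P" for w
  proof -
    have wf: "{w} face_of P" using w by (simp add: face_of_singleton)
    have fw: "f {w} face_of S" using face wf by blast
    have "f {w} \<noteq> {}" using inj[of "{w}" "{}"] wf f_empty by auto
    moreover have "compact S" "convex S"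
      unfolding S using C by (auto intro: compact_convex_hull finite_imp_compact aff_independent_finite)
    then have "compact (f {w})" "convex (f {w})"
      using fw face_of_imp_compact face_of_imp_convex by blast+
    ultimately obtain g where g: "g extreme_point_of f {w}"
      by (meson extreme_point_exists_convex)
    then have gS: "g extreme_point_of S" "g \<in> f {w}"
      using fw extreme_point_of_face by blast+
    then obtain F where F: "F face_of P" "f F = {g}"
      using lift by (metis face_of_singleton)
    have "F \<subseteq> {w}" using mono[OF F(1) wf] F(2) gS by simp
    moreover have "F \<noteq> {}" using F(2) f_empty by auto
    ultimately have "F = {w}" by blast
    then show ?thesis
      using F gS S C extreme_point_of_convex_hull_affine_independent by metis
  qed
  then obtain g where g: "\<And>w. w extreme_point_of P \<Longrightarrow> g w \<in> C \<and> f {w} = {g w}" by metis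
  have opp: "convex hull (C - {g v}) face_of S"
    unfolding S using C by (subst face_of_convex_hull_affine_independent) auto
  then obtain F where F: "F face_of P" "f F = convex hull (C - {g v})" using lift by blast
  have "v \<in> F \<Longrightarrow> g v \<in> convex hull (C - {g v})"
    using mono[of "{v}" F] F v g[OF v] by (simp add: face_of_singleton)
  moreover have "g v \<notin> convex hull (C - {g v})"
    using C g[OF v] convex_hull_subset_affine_hull unfolding affine_dependent_def by blast
  ultimately have "v \<notin> F" by blast
  moreover have "w \<in> F" if w: "w extreme_point_of P" "w \<noteq> v" for w
  proof -
    have "g w \<noteq> g v"
      using inj[of "{w}" "{v}"] w v g by (auto simp: face_of_singleton)
    then have "f {w} \<subseteq> f F" using g[OF w(1)] F by (auto intro: hull_inc)
    then show ?thesis using mono[of "{w}" F] F w by (simp add: face_of_singleton)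
  qed
  ultimately show thesis using that F by blast
qed

text \<open>
  The kernel of \<open>A'\<close> is the graph of a linear map with nonnegative matrix \<open>c\<close>, which computes the
  dependent coordinates, those in \<open>J\<close>, from the free ones, those in \<open>supp_index A - J\<close>.
\<close>

definition nonneg_kernel_form :: "int^'n^'l \<Rightarrow> 'n set \<Rightarrow> ('n \<Rightarrow> 'n \<Rightarrow> real) \<Rightarrow> bool" where
  "nonneg_kernel_form A J c \<longleftrightarrow>
     J \<subseteq> supp_index A \<and> (\<forall>j\<in>J. \<forall>k\<in>supp_index A - J. 0 \<le> c j k) \<and>
     sub_ker A = {x \<in> coord_subspace (supp_index A).
                    \<forall>j\<in>J. x $ j = (\<Sum>k\<in>supp_index A - J. c j k * x $ k)}"

text \<open>
  This expresses that the polytope spans the kernel: for a point \<open>p\<close> of the polytope that is positive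
  on the whole index set, and small \<open>e > 0\<close>, the vector \<open>p + e x\<close> is a positive multiple of a
  point of the polytope, so that \<open>x\<close> is a combination of two such points.
\<close>

lemma polytope_spans_sub_ker:
  assumes T: "linear T" and fix_P: "\<And>x. x \<in> polytope_of A \<Longrightarrow> T x = x" and x: "x \<in> sub_ker A"
  shows "T x = x"
proof (cases "supp_index A = {}")
  case True
  then have "x = 0" using x by (auto simp: mem_sub_ker coord_subspace_def vec_eq_iff)
  then show ?thesis using T by (simp add: linear_0)
next
  case False
  obtain p where p: "p \<in> polytope_of A" "\<And>j. j \<in> supp_index A \<Longrightarrow> 0 < p $ j"
    using convex_point_positive_on[OF polytope_imp_convex[OF polytope_polytope_of] _ False]
    by (auto simp: mem_polytope_of supp_index_def)
  \<comment> \<open>Small enough that \<open>e * \<bar>x $ j\<bar> < p $ j\<close> on the index set; the 1 keeps the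
    denominator positive if \<open>x = 0\<close>.\<close>
  define e where "e = Min ((\<lambda>j. p $ j) ` supp_index A) / (1 + (\<Sum>j\<in>UNIV. \<bar>x $ j\<bar>))"
  have pos: "0 < 1 + (\<Sum>j\<in>UNIV. \<bar>x $ j\<bar>)" by (simp add: add_pos_nonneg sum_nonneg)
  have e: "0 < e"
    unfolding e_def using False p pos by (intro divide_pos_pos) auto
  define y where "y = p + e *\<^sub>R x"
  have ypos: "0 < y $ j" if "j \<in> supp_index A" for j
  proof -
    have "\<bar>x $ j\<bar> \<le> (\<Sum>j\<in>UNIV. \<bar>x $ j\<bar>)" by (intro member_le_sum) auto
    then have "e * \<bar>x $ j\<bar> < e * (1 + (\<Sum>j\<in>UNIV. \<bar>x $ j\<bar>))" using e by simp
    also have "\<dots> = Min ((\<lambda>j. p $ j) ` supp_index A)" using pos by (simp add: e_def)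
    also have "\<dots> \<le> p $ j" using that by simp
    finally have "\<bar>e * x $ j\<bar> < p $ j" using e by (simp add: abs_mult)
    then show ?thesis by (simp add: y_def abs_less_iff)
  qed
  have y: "y \<in> sub_ker A"
    unfolding y_def using p x
    by (intro subspace_add subspace_mul subspace_sub_ker) (auto simp: mem_polytope_of)
  then have "y $ j = 0" if "j \<notin> supp_index A" for j
    using that by (auto simp: mem_sub_ker coord_subspace_def)
  then have ynn: "0 \<le> y $ j" for j using ypos by (cases "j \<in> supp_index A") (auto simp: less_imp_le)
  define s where "s = (\<Sum>j\<in>UNIV. y $ j)"
  obtain j where "j \<in> supp_index A" using False by blast
  then have s: "0 < s"
    unfolding s_def using ypos ynn by (intro sum_pos2[of _ j]) auto
  have "(1 / s) *\<^sub>R y \<in> polytope_of A"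
    using y ynn s subspace_mul[OF subspace_sub_ker y, of "1 / s"]
    by (auto simp: mem_polytope_of sum_divide_distrib[symmetric] s_def[symmetric])
  then have "T ((1 / s) *\<^sub>R y) = (1 / s) *\<^sub>R y" by (rule fix_P)
  then have "T y = y" using s T by (simp add: linear_scale)
  then have "T p + e *\<^sub>R T x = p + e *\<^sub>R x"
    using T by (simp add: y_def linear_add linear_scale)
  then show ?thesis using fix_P[OF p(1)] e by simp
qed

text \<open>
  The coordinate \<open>h v\<close> is positive at the vertex \<open>v\<close> and zero at all other vertices. So the
  coefficient of \<open>v\<close> in a combination \<open>x\<close> of the vertices is \<open>x $ h v / v $ h v\<close>, and the map \<open>T\<close>
  that rebuilds a vector from its coordinates \<open>h v\<close> is the identity on the polytope, hence on the
  kernel. The free coordinates are those of the form \<open>h v\<close>. As \<open>h\<close> is injective, the set of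
  vertices is finite.
\<close>

lemma comb_simplex_imp_nonneg_kernel_form:
  assumes "comb_simplex (polytope_of A)"
  shows "\<exists>J c. nonneg_kernel_form A J c"
proof -
  let ?P = "polytope_of A"
  let ?I = "supp_index A"
  define V where "V = {v. v extreme_point_of ?P}"
  have VP: "V \<subseteq> ?P" by (auto simp: V_def extreme_point_of_def)
  have "\<exists>h. 0 < v $ h \<and> (\<forall>w\<in>V. w \<noteq> v \<longrightarrow> w $ h = 0)" if "v \<in> V" for v
  proof -
    have "v extreme_point_of ?P" "v \<in> ?P" using that VP by (auto simp: V_def)
    then obtain F where F: "F face_of ?P" "v \<notin> F"
      and "\<And>w. w extreme_point_of ?P \<Longrightarrow> w \<noteq> v \<Longrightarrow> w \<in> F"
      using comb_simplex_face_opposite_vertex[OF assms] by metis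
    then have rest: "w \<in> F" if "w \<in> V" "w \<noteq> v" for w using that by (simp add: V_def)
    obtain h where "0 < v $ h" "\<And>x. x \<in> F \<Longrightarrow> x $ h = 0"
      using face_vanishing_coordinate[OF F(1) \<open>v \<in> ?P\<close> F(2)] by metis
    then show ?thesis using rest by auto
  qed
  then obtain h where h: "\<And>v. v \<in> V \<Longrightarrow> 0 < v $ h v"
    and h0: "\<And>v w. v \<in> V \<Longrightarrow> w \<in> V \<Longrightarrow> w \<noteq> v \<Longrightarrow> w $ h v = 0" by metis
  have inj: "inj_on h V" by (intro inj_onI) (metis h h0 less_irrefl)
  have fin: "finite V" using finite_imageD[OF _ inj] by simp
  define T where "T x = (\<Sum>v\<in>V. (x $ h v / v $ h v) *\<^sub>R v)" for x :: "real^'a"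
  have lin: "linear T"
    by (auto simp: T_def linear_iff sum.distrib add_divide_distrib scaleR_add_left scaleR_sum_right)
  have fix_P: "T x = x" if "x \<in> ?P" for x
  proof -
    have PV: "?P = convex hull V"
      unfolding V_def by (intro Krein_Milman_Minkowski polytope_imp_compact polytope_imp_convex
          polytope_polytope_of)
    then have "x \<in> convex hull V" using that by (simp only: PV)
    then obtain u where u: "x = (\<Sum>v\<in>V. u v *\<^sub>R v)"
      by (auto simp: convex_hull_finite[OF fin])
    have "x $ h v = u v * v $ h v" if "v \<in> V" for v
    proof -
      have "x $ h v = (\<Sum>w\<in>V. u w * w $ h v)"
        by (subst u) simp
      also have "\<dots> = u v * v $ h v"
        by (rule sum_eq_single[OF fin that]) (simp add: h0 that)
      finally show ?thesis .
    qed
    then have "x $ h v / v $ h v = u v" if "v \<in> V" for v using that h[OF that] by simp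
    then have "T x = (\<Sum>v\<in>V. u v *\<^sub>R v)" unfolding T_def by (intro sum.cong) auto
    then show ?thesis by (rule trans[OF _ u[symmetric]])
  qed
  have T: "T x = x" if "x \<in> sub_ker A" for x
    by (rule polytope_spans_sub_ker[OF lin fix_P that])
  have hI: "h ` V \<subseteq> ?I"
  proof
    fix k assume "k \<in> h ` V"
    then obtain v where "v \<in> V" "k = h v" by blast
    then show "k \<in> ?I" using h[of v] VP by (auto simp: supp_index_def intro!: bexI[of _ v])
  qed
  define g where "g = inv_into V h"
  have g: "g (h v) = v" if "v \<in> V" for v using that inj by (simp add: g_def)
  define c where "c j k = g k $ j / g k $ k" for j k
  have Tc: "T x $ j = (\<Sum>k\<in>h ` V. c j k * x $ k)" for x j
    by (simp add: T_def sum.reindex[OF inj] c_def g mult.commute)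
  have IJ: "?I - (?I - h ` V) = h ` V" using hI by blast
  have "nonneg_kernel_form A (?I - h ` V) c"
    unfolding nonneg_kernel_form_def IJ
  proof (intro conjI ballI)
    show "0 \<le> c j k" if "k \<in> h ` V" for j k
      using that VP h by (auto simp: c_def g mem_polytope_of less_imp_le intro!: divide_nonneg_nonneg)
    show "sub_ker A = {x \<in> coord_subspace ?I. \<forall>j\<in>?I - h ` V. x $ j = (\<Sum>k\<in>h ` V. c j k * x $ k)}"
      (is "_ = ?R")
    proof (intro equalityI subsetI)
      show "x \<in> ?R" if "x \<in> sub_ker A" for x
        using T[OF that] that by (auto simp: mem_sub_ker Tc[symmetric])
      show "x \<in> sub_ker A" if x: "x \<in> ?R" for x
      proof -
        have "T x \<in> sub_ker A"
          unfolding T_def using VP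
          by (intro subspace_sum subspace_mul subspace_sub_ker) (auto simp: mem_polytope_of)
        moreover have "T x $ j = x $ j" for j
        proof -
          consider "j \<in> ?I - h ` V" | "j \<in> h ` V" | "j \<notin> ?I" by blast
          then show ?thesis
          proof cases
            case 1
            then show ?thesis using x by (simp add: Tc)
          next
            case 2
            then obtain v where v: "v \<in> V" "j = h v" by blast
            have "T x $ j = (\<Sum>w\<in>V. (x $ h w / w $ h w) * w $ j)"
              by (simp add: T_def)
            also have "\<dots> = (x $ h v / v $ h v) * v $ j"
              by (rule sum_eq_single[OF fin v(1)]) (simp add: h0 v)
            finally show ?thesis using v h[OF v(1)] by simp
          next
            case 3
            then show ?thesis
              using x calculation by (auto simp: mem_sub_ker coord_subspace_def)
          qed
        qed
        ultimately show ?thesis by (metis vec_eq_iff)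
      qed
    qed
  qed auto
  then show ?thesis by blast
qed

text \<open>
  The point of the graph over a unit vector: \<open>b\<close> has coordinate 1 at the free index \<open>k\<close> and 0 at
  the other free indices.
\<close>

lemma nonneg_kernel_form_basis:
  assumes "nonneg_kernel_form A J c" and k: "k \<in> supp_index A - J"
  defines "b \<equiv> \<chi> j. if j = k then 1 else if j \<in> J then c j k else 0"
  shows "b \<in> sub_ker A"
proof -
  have "(\<Sum>h\<in>supp_index A - J. c j h * b $ h) = c j k" for j
  proof -
    have "(\<Sum>h\<in>supp_index A - J. c j h * b $ h) = (\<Sum>h\<in>{k}. c j h * b $ h)"
      using k by (intro sum.mono_neutral_right) (auto simp: b_def)
    then show ?thesis by (simp add: b_def)
  qed
  then show ?thesis
    using assms(1) k by (auto simp: nonneg_kernel_form_def coord_subspace_def b_def)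
qed

lemma comb_equiv_refl: "comb_equiv P P"
  unfolding comb_equiv_def by (rule exI[of _ id]) auto

lemma simplex_imp_comb_simplex: "k simplex P \<Longrightarrow> comb_simplex P"
  unfolding comb_simplex_def using comb_equiv_refl by blast

text \<open>
  The basis vectors of the kernel that belong to the free coordinates are nonnegative; rescaled to
  coordinate sum 1 they are the vertices \<open>v k\<close> of the polytope. A point \<open>x\<close> has the nonnegative
  coefficients \<open>x $ k * s k\<close> with respect to them, and comparing coordinate sums shows that these add
  up to 1. So the polytope is itself a simplex.
\<close>

lemma nonneg_kernel_form_imp_comb_simplex:
  assumes J: "nonneg_kernel_form A J c"
  shows "comb_simplex (polytope_of A)"
proof -
  let ?P = "polytope_of A"
  define K where "K = supp_index A - J"
  define b where "b k = (\<chi> j. if j = k then 1 else if j \<in> J then c j k else 0)" for k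
  have b: "b k \<in> sub_ker A" if "k \<in> K" for k
    using nonneg_kernel_form_basis[OF J] that by (simp add: b_def K_def)
  have bnn: "0 \<le> b k $ j" if "k \<in> K" for k j
    using J that by (auto simp: b_def K_def nonneg_kernel_form_def)
  define s where "s k = (\<Sum>j\<in>UNIV. b k $ j)" for k
  have s: "0 < s k" if "k \<in> K" for k
    unfolding s_def using bnn[OF that] by (intro sum_pos2[of _ k]) (auto simp: b_def)
  have s0: "s k \<noteq> 0" if "k \<in> K" for k using s[OF that] by simp
  define v where "v k = (1 / s k) *\<^sub>R b k" for k
  have vP: "v k \<in> ?P" if "k \<in> K" for k
    using b[OF that] bnn[OF that] s[OF that] subspace_mul[OF subspace_sub_ker b[OF that], of "1 / s k"]
    by (auto simp: mem_polytope_of v_def sum_divide_distrib[symmetric] s_def[symmetric])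
  have vk: "v k $ h = (if h = k then 1 / s k else 0)" if "k \<in> K" "h \<in> K" for k h
    using that by (auto simp: v_def b_def K_def)
  have inj: "inj_on v K"
    by (intro inj_onI) (metis vk s zero_less_divide_1_iff less_irrefl)
  have "?P \<subseteq> convex hull (v ` K)"
  proof
    fix x assume x: "x \<in> ?P"
    have "x $ j = (\<Sum>k\<in>K. (x $ k * s k) *\<^sub>R v k) $ j" for j
    proof -
      have "(\<Sum>k\<in>K. (x $ k * s k) *\<^sub>R v k) $ j = (\<Sum>k\<in>K. x $ k * b k $ j)"
        unfolding sum_component by (rule sum.cong[OF refl]) (simp add: v_def s0)
      also have "\<dots> = x $ j"
      proof (cases "j \<in> J")
        case True
        then have "(\<Sum>k\<in>K. x $ k * b k $ j) = (\<Sum>k\<in>K. c j k * x $ k)"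
          by (intro sum.cong) (auto simp: b_def K_def)
        then show ?thesis using x J True by (simp add: mem_polytope_of nonneg_kernel_form_def K_def)
      next
        case False
        then have "(\<Sum>k\<in>K. x $ k * b k $ j) = (\<Sum>k\<in>K. if j = k then x $ k else 0)"
          by (intro sum.cong) (auto simp: b_def)
        also have "\<dots> = x $ j"
          using x False by (auto simp: K_def mem_polytope_of mem_sub_ker coord_subspace_def)
        finally show ?thesis .
      qed
      finally show ?thesis by simp
    qed
    then have xv: "(\<Sum>k\<in>K. (x $ k * s k) *\<^sub>R v k) = x" unfolding vec_eq_iff by metis
    have "(\<Sum>k\<in>K. x $ k * s k) = (\<Sum>k\<in>K. (x $ k * s k) * (\<Sum>j\<in>UNIV. v k $ j))"
      using vP by (intro sum.cong) (auto simp: mem_polytope_of)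
    also have "\<dots> = (\<Sum>j\<in>UNIV. \<Sum>k\<in>K. (x $ k * s k) * v k $ j)"
      unfolding sum_distrib_left by (rule sum.swap)
    also have "\<dots> = (\<Sum>j\<in>UNIV. (\<Sum>k\<in>K. (x $ k * s k) *\<^sub>R v k) $ j)" by simp
    also have "\<dots> = (\<Sum>j\<in>UNIV. x $ j)" unfolding xv ..
    finally have "(\<Sum>k\<in>K. x $ k * s k) = 1" using x by (simp add: mem_polytope_of)
    then have "(\<Sum>k\<in>K. (x $ k * s k) *\<^sub>R v k) \<in> convex hull (v ` K)"
      using x s by (intro convex_sum) (auto simp: mem_polytope_of less_imp_le hull_inc)
    then show "x \<in> convex hull (v ` K)" unfolding xv .
  qed
  moreover have "convex hull (v ` K) \<subseteq> ?P"
    using vP polytope_imp_convex[OF polytope_polytope_of] by (intro hull_minimal) auto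
  moreover have "\<not> affine_dependent (v ` K)"
  proof
    assume "affine_dependent (v ` K)"
    then obtain u k where k: "k \<in> K" "u (v k) \<noteq> 0" and "(\<Sum>w\<in>v ` K. u w *\<^sub>R w) = 0"
      by (auto simp: affine_dependent_explicit_finite)
    then have "0 = (\<Sum>h\<in>K. u (v h) * v h $ k)"
      by (simp add: sum.reindex[OF inj] vec_eq_iff)
    also have "\<dots> = (\<Sum>h\<in>{k}. u (v h) * v h $ k)"
      using k vk by (intro sum.mono_neutral_right) auto
    finally show False using k vk[of k k] s[of k] by simp
  qed
  ultimately have "(int (card (v ` K)) - 1) simplex ?P"
    unfolding simplex_def by (intro exI[of _ "v ` K"]) auto
  then show ?thesis by (rule simplex_imp_comb_simplex)
qed

text \<open>
  The columns in \<open>J\<close> form a basis of the column space of \<open>A'\<close>: a linear relation between them is a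
  kernel vector with vanishing free coordinates, hence zero, and the kernel vector of a free
  coordinate \<open>k\<close> expresses column \<open>k\<close> by the columns in \<open>J\<close>.
\<close>

lemma sub_rank_nonneg_kernel_form:
  fixes A :: "int^'n^'l"
  assumes J: "nonneg_kernel_form A J c"
  shows "sub_rank A = card J"
proof -
  define a where "a j = column j (map_matrix real_of_int A)" for j
  have mult: "map_matrix real_of_int A *v x = (\<Sum>j\<in>UNIV. x $ j *\<^sub>R a j)" for x
    unfolding a_def matrix_mult_sum by (simp add: scalar_mult_eq_scaleR)
  have JI: "J \<subseteq> supp_index A" using J by (simp add: nonneg_kernel_form_def)
  have indep: "u j = 0" if "j \<in> J" "(\<Sum>j\<in>J. u j *\<^sub>R a j) = 0" for u j
  proof -
    define x where "x = (\<chi> j. if j \<in> J then u j else 0)"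
    have "map_matrix real_of_int A *v x = (\<Sum>j\<in>J. x $ j *\<^sub>R a j)"
      unfolding mult by (intro sum.mono_neutral_right) (auto simp: x_def)
    also have "\<dots> = (\<Sum>j\<in>J. u j *\<^sub>R a j)" by (simp add: x_def)
    finally have "x \<in> sub_ker A" using that(2) JI by (auto simp: mem_sub_ker coord_subspace_def x_def)
    then have "x $ j = (\<Sum>k\<in>supp_index A - J. c j k * x $ k)"
      using J that(1) by (auto simp: nonneg_kernel_form_def)
    also have "\<dots> = 0" by (simp add: x_def)
    finally show ?thesis using that(1) by (simp add: x_def)
  qed
  have inj: "inj_on a J"
  proof (rule inj_onI, rule ccontr)
    fix i j assume ij: "i \<in> J" "j \<in> J" "a i = a j" "i \<noteq> j"
    define u where "u h = (if h = i then 1 else if h = j then -1 else (0::real))" for h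
    have "(\<Sum>h\<in>J. u h *\<^sub>R a h) = (\<Sum>h\<in>{i, j}. u h *\<^sub>R a h)"
      using ij by (intro sum.mono_neutral_right) (auto simp: u_def)
    also have "\<dots> = 0" using ij by (simp add: u_def)
    finally show False using indep[OF ij(1), of u] by (simp add: u_def)
  qed
  have "independent (a ` J)"
  proof
    assume "dependent (a ` J)"
    then obtain u j where "j \<in> J" "u (a j) \<noteq> 0" "(\<Sum>w\<in>a ` J. u w *\<^sub>R w) = 0"
      by (auto simp: dependent_finite)
    then show False using indep[of j "u \<circ> a"] by (simp add: sum.reindex[OF inj])
  qed
  moreover have "a ` supp_index A \<subseteq> span (a ` J)"
  proof (rule image_subsetI)
    fix k assume k: "k \<in> supp_index A"
    show "a k \<in> span (a ` J)"
    proof (cases "k \<in> J")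
      case False
      define b where "b = (\<chi> j. if j = k then 1 else if j \<in> J then c j k else 0)"
      have "b \<in> sub_ker A"
        unfolding b_def by (rule nonneg_kernel_form_basis[OF J]) (use k False in auto)
      then have "map_matrix real_of_int A *v b = 0" by (simp add: mem_sub_ker)
      then have "0 = (\<Sum>j\<in>UNIV. b $ j *\<^sub>R a j)" unfolding mult by (rule sym)
      also have "\<dots> = (\<Sum>j\<in>insert k J. b $ j *\<^sub>R a j)"
        by (intro sum.mono_neutral_right) (auto simp: b_def)
      also have "\<dots> = a k + (\<Sum>j\<in>J. b $ j *\<^sub>R a j)" using False by (simp add: b_def)
      finally have "a k = - (\<Sum>j\<in>J. b $ j *\<^sub>R a j)" by (simp add: eq_neg_iff_add_eq_0)
      then show ?thesis by (auto intro!: span_neg span_sum span_scale intro: span_base)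
    qed (auto intro: span_base)
  qed
  ultimately have "dim (a ` supp_index A) = card (a ` J)"
    using JI by (intro dim_unique[of "a ` J"]) auto
  moreover have "sub_rank A = dim (a ` supp_index A)"
    by (simp add: sub_rank_def a_def[abs_def])
  ultimately show ?thesis by (simp add: card_image[OF inj])
qed

text \<open>
  The kernel of \<open>A\<close> has dimension \<open>n - r \<le> 2\<close>, and the polytope lies in its intersection with the
  hyperplane of coordinate sum 1, which does not contain the origin.
\<close>

lemma comb_simplex_of_small_corank:
  fixes A :: "int^'n^'l"
  assumes "CARD('n) \<le> rank (map_matrix real_of_int A) + 2"
  shows "comb_simplex (polytope_of A)"
proof -
  let ?B = "map_matrix real_of_int A"
  let ?P = "polytope_of A"
  have "dim {x. ?B *v x = 0} + rank ?B = CARD('n)"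
  proof -
    have "{y \<in> UNIV. \<forall>x\<in>span (rows ?B). orthogonal x y} = {x. ?B *v x = 0}"
    proof -
      have "(\<forall>x\<in>span (rows ?B). orthogonal x y) \<longleftrightarrow> (\<forall>x\<in>rows ?B. orthogonal x y)" for y
        by (meson orthogonal_commute orthogonal_to_span span_base)
      also have "(\<forall>x\<in>rows ?B. orthogonal x y) \<longleftrightarrow> ?B *v y = 0" for y
      proof -
        have "orthogonal (row i ?B) y \<longleftrightarrow> (?B *v y) $ i = 0" for i
          by (simp add: orthogonal_def row_def inner_vec_def matrix_vector_mult_def)
        then show ?thesis unfolding rows_def vec_eq_iff[of "?B *v y"] by auto
      qed
      finally show ?thesis by simp
    qed
    then show ?thesis
      using dim_subspace_orthogonal_to_vectors[of "span (rows ?B)" UNIV]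
      by (simp add: row_rank_def)
  qed
  moreover have "dim (insert 0 ?P) \<le> dim {x. ?B *v x = 0}"
    by (intro dim_subset) (auto simp: polytope_of_def)
  ultimately have "dim (insert 0 ?P) \<le> 2" using assms by simp
  moreover have "aff_dim (insert 0 ?P) = int (dim (insert 0 ?P))"
    by (intro aff_dim_zero hull_inc) auto
  moreover have "0 \<notin> affine hull ?P"
  proof -
    have "affine {x::real^'n. (\<Sum>j\<in>UNIV. x $ j) = 1}"
      by (auto simp: affine_def sum.distrib sum_distrib_left[symmetric])
    then have "affine hull ?P \<subseteq> {x. (\<Sum>j\<in>UNIV. x $ j) = 1}"
      by (intro hull_minimal) (auto simp: mem_polytope_of)
    then show ?thesis by auto
  qed
  ultimately have "aff_dim ?P \<le> 1" by (simp add: aff_dim_insert)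
  then obtain k where "k simplex ?P" using polytope_lowdim_imp_simplex polytope_polytope_of by blast
  then show ?thesis by (rule simplex_imp_comb_simplex)
qed

section \<open>Block form and normal vectors\<close>

lemma sub_ker_iff_solutions:
  fixes A :: "int^'n^'l"
  assumes rho: "bij_betw \<rho> {..<CARD('l)} UNIV"
    and sigma: "bij_betw \<sigma> {..<card (supp_index A)} (supp_index A)"
  shows "x \<in> sub_ker A \<longleftrightarrow>
    x \<in> coord_subspace (supp_index A) \<and> (\<lambda>k. x $ \<sigma> k) \<in> solutions (submat A \<rho> \<sigma>)"
proof -
  let ?L = "\<lambda>i. \<Sum>j\<in>supp_index A. real_of_int (A $ i $ j) * x $ j"
  have "(\<Sum>k<card (supp_index A). real_of_int (A $ i $ \<sigma> k) * x $ \<sigma> k) = ?L i" for i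
    by (rule sum.reindex_bij_betw[OF sigma])
  then have "(\<lambda>k. x $ \<sigma> k) \<in> solutions (submat A \<rho> \<sigma>) \<longleftrightarrow> (\<forall>i<CARD('l). ?L (\<rho> i) = 0)"
    by (simp add: solutions_def submat_def)
  also have "\<dots> \<longleftrightarrow> (\<forall>i\<in>\<rho> ` {..<CARD('l)}. ?L i = 0)" by auto
  also have "\<dots> \<longleftrightarrow> (\<forall>i. ?L i = 0)" using rho by (simp add: bij_betw_def)
  finally show ?thesis by (simp add: sub_ker_def)
qed

lemma inner_coord_subspace:
  assumes "x \<in> coord_subspace I"
  shows "\<mu> \<bullet> x = (\<Sum>j\<in>I. \<mu> $ j * x $ j)"
  using assms by (auto simp: inner_vec_def coord_subspace_def intro!: sum.mono_neutral_right)

text \<open>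
  The first \<open>r\<close> rows of the block matrix, with entries moved back to the original column indices by
  \<open>\<tau>\<close>, are the normal vectors, and their pivots are the distinguished indices. Since row operations
  preserve dimensions, the existence of the block form already implies that \<open>r\<close> is at most the number
  of rows and of columns.
\<close>

lemma block_form_imp_normal_vectors:
  fixes A :: "int^'n^'l"
  assumes "reducible_to_block_form A r"
  shows "has_normal_vectors A r"
proof -
  define I where "I = supp_index A"
  define m where "m = CARD('l)"
  define s where "s = card I"
  from assms obtain \<rho> \<sigma> q D C where rho: "bij_betw \<rho> {..<m} UNIV"
    and sigma: "bij_betw \<sigma> {..<s} I"
    and q: "q \<le> s - r" and D: "D \<in> carrier_mat r r" and C: "C \<in> carrier_mat r q"
    and diag: "diagonal_mat D" "\<forall>i<r. D $$ (i, i) < 0"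
    and nonneg: "\<forall>i<r. \<forall>k<q. 0 \<le> C $$ (i, k)"
    and ops: "int_row_op\<^sup>*\<^sup>* (submat A \<rho> \<sigma>) (block_form m s r q D C)"
    unfolding reducible_to_block_form_def m_def I_def s_def by blast
  define N where "N = block_form m s r q D C"
  have "dim_row N = r + (m - r)" "dim_col N = r + (s - r)"
    using D by (auto simp: N_def block_form_def)
  moreover have dims: "dim_row N = m" "dim_col N = s"
    using int_row_ops_dim[OF ops] by (auto simp: N_def submat_def m_def s_def I_def)
  ultimately have rm: "r \<le> m" and rs: "r \<le> s" by auto
  have N: "N $$ (i, k) = (if i < r then if k < r then D $$ (i, k)
      else if k < r + q then C $$ (i, k - r) else 0 else 0)" if "i < m" "k < s" for i k
    unfolding N_def using that by (intro block_form_index[OF D C q rm rs])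
  define \<tau> where "\<tau> = inv_into {..<s} \<sigma>"
  have tau: "\<tau> (\<sigma> k) = k" if "k < s" for k
    using that sigma by (simp add: \<tau>_def bij_betw_def)
  have sI: "\<sigma> k \<in> I" if "k < s" for k using that sigma by (auto simp: bij_betw_def)
  define \<mu> :: "nat \<Rightarrow> real^'n"
    where "\<mu> i = (\<chi> j. if j \<in> I then real_of_int (N $$ (i, \<tau> j)) else 0)" for i
  have mu: "\<mu> i $ \<sigma> k = real_of_int (N $$ (i, k))" if "k < s" for i k
    using that by (simp add: \<mu>_def sI tau)
  have inner: "\<mu> i \<bullet> x = (\<Sum>k<s. real_of_int (N $$ (i, k)) * x $ \<sigma> k)"
    if "x \<in> coord_subspace I" for i x
    unfolding inner_coord_subspace[OF that]
    using sum.reindex_bij_betw[OF sigma, of "\<lambda>j. \<mu> i $ j * x $ j"] by (simp add: mu)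
  have "(\<lambda>k. x $ \<sigma> k) \<in> solutions N \<longleftrightarrow> (\<forall>i<r. \<mu> i \<bullet> x = 0)" if "x \<in> coord_subspace I" for x
  proof -
    have "\<mu> i \<bullet> x = 0" if "i < m" "\<not> i < r" for i
      unfolding inner[OF \<open>x \<in> coord_subspace I\<close>] using that by (auto simp: N intro!: sum.neutral)
    then have "(\<forall>i<m. \<mu> i \<bullet> x = 0) \<longleftrightarrow> (\<forall>i<r. \<mu> i \<bullet> x = 0)"
      using rm by (metis order_less_le_trans)
    then show ?thesis by (simp add: solutions_def dims inner[OF that])
  qed
  then have "sub_ker A = coord_subspace I \<inter> (\<Inter>i<r. orthogonal_comp {\<mu> i})"
    using sub_ker_iff_solutions[OF rho[unfolded m_def] sigma[unfolded s_def I_def]]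
      int_row_ops_solutions[OF ops]
    by (auto simp: N_def I_def orthogonal_comp_def orthogonal_def)
  moreover have "axis (\<sigma> i) 1 \<bullet> \<mu> i < 0" if "i < r" for i
    using that rm rs diag(2) by (simp add: inner_axis' mu N)
  moreover have "axis (\<sigma> k) 1 \<bullet> \<mu> i = 0" if "i < r" "k < r" "k \<noteq> i" for i k
    using that rm rs diag(1) D by (simp add: inner_axis' mu N diagonal_mat_def)
  moreover have "axis h 1 \<bullet> \<mu> i \<ge> 0" if i: "i < r" and h: "h \<in> I" "h \<noteq> \<sigma> i" for i h
  proof -
    obtain k where k: "k < s" "h = \<sigma> k" using h sigma by (auto simp: bij_betw_def)
    then have "k \<noteq> i" using h by blast
    then show ?thesis
      using i k rm diag(1) D nonneg by (auto simp: inner_axis' mu N diagonal_mat_def)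
  qed
  moreover have "\<mu> i \<in> coord_subspace I \<and> \<sigma> i \<in> I" if "i < r" for i
    using that rs sI by (auto simp: \<mu>_def coord_subspace_def)
  ultimately show ?thesis
    unfolding has_normal_vectors_def I_def[symmetric] by (intro exI[of _ \<mu>] exI[of _ \<sigma>]) auto
qed

text \<open>
  The equation given by the \<open>i\<close>-th normal vector contains no distinguished coordinate besides
  \<open>j i\<close>, so it can be solved for it; dividing by the negative coefficient at \<open>j i\<close> makes the other
  coefficients nonnegative on the right-hand side.
\<close>

lemma normal_vectors_imp_nonneg_kernel_form:
  assumes "has_normal_vectors A r"
  shows "\<exists>J c. nonneg_kernel_form A J c"
proof -
  define I where "I = supp_index A"
  from assms obtain \<mu> j where normals: "\<forall>i<r. \<mu> i \<in> coord_subspace I \<and> j i \<in> I"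
      "\<forall>i<r. axis (j i) 1 \<bullet> \<mu> i < 0 \<and> (\<forall>k<r. k \<noteq> i \<longrightarrow> axis (j k) 1 \<bullet> \<mu> i = 0) \<and>
        (\<forall>h\<in>I. h \<noteq> j i \<longrightarrow> axis h 1 \<bullet> \<mu> i \<ge> 0)"
    and ker: "sub_ker A = coord_subspace I \<inter> (\<Inter>i<r. orthogonal_comp {\<mu> i})"
    unfolding has_normal_vectors_def I_def by blast
  then have jI: "\<And>i. i < r \<Longrightarrow> j i \<in> I"
    and neg: "\<And>i. i < r \<Longrightarrow> \<mu> i $ j i < 0"
    and zero: "\<And>i k. i < r \<Longrightarrow> k < r \<Longrightarrow> k \<noteq> i \<Longrightarrow> \<mu> i $ j k = 0"
    and nonneg: "\<And>i h. i < r \<Longrightarrow> h \<in> I \<Longrightarrow> h \<noteq> j i \<Longrightarrow> 0 \<le> \<mu> i $ h"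
    by (auto simp: inner_axis')
  have inj: "inj_on j {..<r}"
    by (intro inj_onI) (metis lessThan_iff less_irrefl neg zero)
  define J where "J = j ` {..<r}"
  define c where "c h k = (let i = inv_into {..<r} j h in - \<mu> i $ k / \<mu> i $ j i)" for h k
  have c: "c (j i) k = - \<mu> i $ k / \<mu> i $ j i" if "i < r" for i k
    using that inj by (simp add: c_def)
  have JI: "J \<subseteq> I" using jI by (auto simp: J_def)
  have "\<mu> i \<bullet> x = 0 \<longleftrightarrow> x $ j i = (\<Sum>k\<in>I - J. c (j i) k * x $ k)"
    if i: "i < r" and x: "x \<in> coord_subspace I" for i x
  proof -
    have "\<mu> i \<bullet> x = (\<Sum>k\<in>J. \<mu> i $ k * x $ k) + (\<Sum>k\<in>I - J. \<mu> i $ k * x $ k)"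
      unfolding inner_coord_subspace[OF x] using sum.subset_diff[OF JI] by (simp add: add.commute)
    also have "(\<Sum>k\<in>J. \<mu> i $ k * x $ k) = \<mu> i $ j i * x $ j i"
      by (rule sum_eq_single) (use i zero in \<open>auto simp: J_def\<close>)
    also have "(\<Sum>k\<in>I - J. \<mu> i $ k * x $ k) = - \<mu> i $ j i * (\<Sum>k\<in>I - J. c (j i) k * x $ k)"
      unfolding sum_distrib_left using neg[OF i] by (intro sum.cong) (auto simp: c[OF i])
    finally have "\<mu> i \<bullet> x = \<mu> i $ j i * (x $ j i - (\<Sum>k\<in>I - J. c (j i) k * x $ k))"
      by (simp add: algebra_simps)
    then show ?thesis using neg[OF i] by simp
  qed
  then have "sub_ker A = {x \<in> coord_subspace I. \<forall>h\<in>J. x $ h = (\<Sum>k\<in>I - J. c h k * x $ k)}"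
    unfolding ker J_def by (auto simp: orthogonal_comp_def orthogonal_def)
  moreover have "0 \<le> c h k" if h: "h \<in> J" and k: "k \<in> I - J" for h k
  proof -
    obtain i where i: "i < r" "h = j i" using h by (auto simp: J_def)
    then have "0 \<le> \<mu> i $ k" using k h by (intro nonneg) auto
    then show ?thesis using neg[OF i(1)] by (simp add: i(2) c[OF i(1)] divide_nonneg_neg divide_nonpos_neg)
  qed
  ultimately have "nonneg_kernel_form A J c"
    using JI unfolding nonneg_kernel_form_def I_def[symmetric] by auto
  then show ?thesis by blast
qed

text \<open>
  The numbering \<open>\<sigma>\<close> lists the dependent columns before the free ones, which turns the kernel form into
  the hypothesis of the elimination lemma.
\<close>

lemma nonneg_kernel_form_imp_block_form:
  fixes A :: "int^'n^'l"
  assumes J: "nonneg_kernel_form A J c"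
  shows "reducible_to_block_form A (card J)"
proof -
  define I where "I = supp_index A"
  define r where "r = card J"
  define s where "s = card I"
  have JI: "J \<subseteq> I" using J by (simp add: nonneg_kernel_form_def I_def)
  have rs: "r \<le> s" unfolding r_def s_def using JI by (intro card_mono) auto
  obtain \<rho> where rho: "bij_betw \<rho> {..<CARD('l)} (UNIV :: 'l set)"
    using ex_bij_betw_nat_finite[OF finite[of UNIV]] by (metis atLeast0LessThan)
  obtain \<sigma>1 where s1: "bij_betw \<sigma>1 {..<r} J"
    using ex_bij_betw_nat_finite[of J] by (auto simp: r_def atLeast0LessThan)
  obtain \<sigma>2 where s2: "bij_betw \<sigma>2 {r..<s} (I - J)"
    using finite_same_card_bij[of "{r..<s}" "I - J"] JI by (auto simp: card_Diff_subset r_def s_def)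
  define \<sigma> where "\<sigma> k = (if k < r then \<sigma>1 k else \<sigma>2 k)" for k
  have sJ: "bij_betw \<sigma> {..<r} J"
    using s1 by (rule bij_betw_cong[THEN iffD1, rotated]) (simp add: \<sigma>_def)
  have sK: "bij_betw \<sigma> {r..<s} (I - J)"
    using s2 by (rule bij_betw_cong[THEN iffD1, rotated]) (simp add: \<sigma>_def)
  have "bij_betw \<sigma> ({..<r} \<union> {r..<s}) (J \<union> (I - J))"
    using sJ sK by (rule bij_betw_combine) auto
  moreover have "{..<r} \<union> {r..<s} = {..<s}" "J \<union> (I - J) = I" using rs JI by auto
  ultimately have sigma: "bij_betw \<sigma> {..<s} I" by simp
  define M where "M = submat A \<rho> \<sigma>"
  have dims: "dim_row M = CARD('l)" "dim_col M = s" by (auto simp: M_def submat_def s_def I_def)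
  define \<tau> where "\<tau> = inv_into {..<s} \<sigma>"
  have tau: "\<tau> (\<sigma> k) = k" if "k < s" for k
    using that sigma by (simp add: \<tau>_def bij_betw_def)
  have sI: "\<sigma> k \<in> I" if "k < s" for k using that sigma by (auto simp: bij_betw_def)
  have sol: "solutions M = {y. \<forall>i<r. y i = (\<Sum>k=r..<dim_col M. c (\<sigma> i) (\<sigma> k) * y k)}"
  proof (rule Set.set_eqI)
    fix y :: "nat \<Rightarrow> real"
    define x :: "real^'n" where "x = (\<chi> j. if j \<in> I then y (\<tau> j) else 0)"
    have xs: "x $ \<sigma> k = y k" if "k < s" for k using that by (simp add: x_def sI tau)
    have xI: "x \<in> coord_subspace I" by (simp add: x_def coord_subspace_def)
    have "y \<in> solutions M \<longleftrightarrow> (\<lambda>k. x $ \<sigma> k) \<in> solutions M"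
      by (simp add: solutions_def dims xs)
    also have "\<dots> \<longleftrightarrow> x \<in> sub_ker A"
      using sub_ker_iff_solutions[OF rho sigma[unfolded s_def I_def]] xI by (simp add: I_def M_def)
    also have "\<dots> \<longleftrightarrow> (\<forall>j\<in>J. x $ j = (\<Sum>k\<in>I - J. c j k * x $ k))"
      using J xI by (simp add: nonneg_kernel_form_def I_def)
    also have "\<dots> \<longleftrightarrow> (\<forall>i\<in>{..<r}. x $ \<sigma> i = (\<Sum>k\<in>I - J. c (\<sigma> i) k * x $ k))"
      using bij_betw_imp_surj_on[OF sJ] by auto
    also have "\<dots> \<longleftrightarrow> (\<forall>i<r. y i = (\<Sum>k=r..<s. c (\<sigma> i) (\<sigma> k) * y k))"
    proof -
      have "(\<Sum>k\<in>I - J. c (\<sigma> i) k * x $ k) = (\<Sum>k=r..<s. c (\<sigma> i) (\<sigma> k) * y k)" for i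
        using sum.reindex_bij_betw[OF sK, of "\<lambda>k. c (\<sigma> i) k * x $ k"] by (simp add: xs)
      then show ?thesis using rs by (auto simp: xs)
    qed
    finally show "y \<in> solutions M \<longleftrightarrow>
        y \<in> {y. \<forall>i<r. y i = (\<Sum>k=r..<dim_col M. c (\<sigma> i) (\<sigma> k) * y k)}" by (simp add: dims)
  qed
  have "0 \<le> c (\<sigma> i) (\<sigma> k)" if "i < r" "r \<le> k" "k < dim_col M" for i k
  proof -
    have "\<sigma> i \<in> J" "\<sigma> k \<in> I - J"
      using that bij_betw_apply[OF sJ, of i] bij_betw_apply[OF sK, of k] by (auto simp: dims)
    then show ?thesis using J by (simp add: nonneg_kernel_form_def I_def)
  qed
  then show ?thesis
    using int_row_ops_to_block_form[OF _ _ sol] rs rho sigma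
    unfolding reducible_to_block_form_def r_def[symmetric] I_def[symmetric] s_def[symmetric] dims
    by (metis M_def order_refl)
qed

theorem theorem4:
  fixes A :: "int^'n^'l" and r r' :: nat
  assumes "CARD('l) \<le> CARD('n)"
    and "r = rank (map_matrix real_of_int A)"
    and "r' = sub_rank A"
  shows "(comb_simplex (polytope_of A) \<longleftrightarrow> reducible_to_block_form A r') \<and>
         (reducible_to_block_form A r' \<longleftrightarrow> has_normal_vectors A r') \<and>
         (CARD('n) \<le> r + 2 \<longrightarrow>
            comb_simplex (polytope_of A) \<and> reducible_to_block_form A r' \<and> has_normal_vectors A r')"
proof -
  have "reducible_to_block_form A r'" if "nonneg_kernel_form A J c" for J c
    using nonneg_kernel_form_imp_block_form[OF that] sub_rank_nonneg_kernel_form[OF that] assms(3)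
    by simp
  then show ?thesis
    using comb_simplex_imp_nonneg_kernel_form nonneg_kernel_form_imp_comb_simplex
      block_form_imp_normal_vectors normal_vectors_imp_nonneg_kernel_form
      comb_simplex_of_small_corank[of A] assms(2)
    by blast
qed

end
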